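(* Let $G=(V,E)$ be a finite undirected graph with $n$ vertices, let $k\ge 1$ be an integer, let $\alpha\ge 1$ be a real number, and let $W\subseteq V$ satisfy $|W|<(\alpha+1)k$. Then the recursive algorithm $\mathrm{Triangulate}(G,W,k)$ (defined in the context, with parameter $\alpha$) either triangulates $G$, by adding edges, in such a way that the vertices of $W$ form a clique and the size of a largest clique of the triangulated graph is $<(2\alpha+1)k$, or it correctly outputs that the cliquewidth of $G$ is larger than $k$.
   Context: A triangulation of a graph $G$ is a chordal graph on the same vertex set obtained from $G$ by adding edges (a graph is chordal, or triangulated, if every cycle of length more than three has a chord). The cliquewidth of $G$ is the minimum, over all triangulations $H$ of $G$, of the number of vertices of a largest clique of $H$ (equivalently treewidth plus 1; equivalently the size of the largest clique in a junction tree of $G$ in which this size is minimized). $G[S]$ denotes the subgraph induced by $S$. A decomposition of $G=(V,E)$ is a partition $(X,A,B,C)$ of $V$ with $A$ and $B$ non-empty ($X$ and $C$ may be empty) such that there are no edges of $G$ between any two of the sets $A,B,C$. Given an integer $k\ge1$, a real $\alpha\ge1$, a graph $G=(V,E)$ with $|V|\ge(2\alpha+1)k$, and $W\subseteq V$, a decomposition $(X,A,B,C)$ of $G$ is a $W$-decomposition with respect to $(k,\alpha)$ if $|W|<(\alpha+1)k$, $|X|\le\alpha k$, $|(W\cap A)\cup X|<(\alpha+1)k$, $|(W\cap B)\cup X|<(\alpha+1)k$ and $|(W\cap C)\cup X|<(\alpha+1)k$. Algorithm $\mathrm{Triangulate}(G,W,k)$ with $G=(V,E)$: If $|V|<(2\alpha+1)k$,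 make $V$ a clique. Otherwise, find a $W$-decomposition $(X,A,B,C)$ of $G$ with respect to $(k,\alpha)$; if none is found (the search finds one whenever one exists), return "cliquewidth $>k$". Otherwise set $W_A=W\cap A$, $W_B=W\cap B$, $W_C=W\cap C$; call $\mathrm{Triangulate}(G[A\cup X],W_A\cup X,k)$, $\mathrm{Triangulate}(G[B\cup X],W_B\cup X,k)$ and $\mathrm{Triangulate}(G[C\cup X],W_C\cup X,k)$; then make $W\cup X$ a clique. The triangulated graph is $G$ together with all edges added in this call and in all recursive calls. If any recursive call returns "cliquewidth $>k$", so does the whole algorithm. *)

theory Defs
  imports Complex_Main
begin

record 'a ugraph =
  verts :: "'a set"
  edges :: "'a set set"

definition pairs :: "'a set \<Rightarrow> 'a set set" where
  "pairs S = {{u, v} | u v. u \<in> S \<and> v \<in> S \<and> u \<noteq> v}"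

definition fin_graph :: "'a ugraph \<Rightarrow> bool" where
  "fin_graph G \<longleftrightarrow> finite (verts G) \<and> edges G \<subseteq> pairs (verts G)"

definition induced :: "'a ugraph \<Rightarrow> 'a set \<Rightarrow> 'a ugraph" where
  "induced G S = \<lparr>verts = verts G \<inter> S, edges = {e \<in> edges G. e \<subseteq> S}\<rparr>"

definition clique :: "'a ugraph \<Rightarrow> 'a set \<Rightarrow> bool" where
  "clique G K \<longleftrightarrow> K \<subseteq> verts G \<and> (\<forall>u\<in>K. \<forall>v\<in>K. u \<noteq> v \<longrightarrow> {u, v} \<in> edges G)"

text \<open>The empty set is a clique, so the maximum also exists for the graph without vertices.\<close>

definition clique_number :: "'a ugraph \<Rightarrow> nat" where
  "clique_number G = Max {card K | K. clique G K}"

text \<open>A cycle is given by the list of its vertices in cyclic order, without repetition.\<close>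

definition cycle_edges :: "'a list \<Rightarrow> 'a set set" where
  "cycle_edges p = {{p ! i, p ! (Suc i mod length p)} | i. i < length p}"

definition cycle :: "'a ugraph \<Rightarrow> 'a list \<Rightarrow> bool" where
  "cycle G p \<longleftrightarrow> length p \<ge> 3 \<and> distinct p \<and> set p \<subseteq> verts G \<and> cycle_edges p \<subseteq> edges G"

definition chord :: "'a ugraph \<Rightarrow> 'a list \<Rightarrow> 'a set \<Rightarrow> bool" where
  "chord G p e \<longleftrightarrow> e \<in> edges G \<and> e \<subseteq> set p \<and> e \<notin> cycle_edges p"

definition chordal :: "'a ugraph \<Rightarrow> bool" where
  "chordal G \<longleftrightarrow> (\<forall>p. cycle G p \<and> length p > 3 \<longrightarrow> (\<exists>e. chord G p e))"

definition triangulation :: "'a ugraph \<Rightarrow> 'a ugraph \<Rightarrow> bool" where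
  "triangulation G H \<longleftrightarrow>
     fin_graph H \<and> verts H = verts G \<and> edges G \<subseteq> edges H \<and> chordal H"

text \<open>
  This is treewidth plus one, and not the width defined by the clique operations on labelled
  graphs that usually goes by this name.
\<close>

definition cliquewidth :: "'a ugraph \<Rightarrow> nat" where
  "cliquewidth G = Min {clique_number H | H. triangulation G H}"

definition no_edges_between :: "'a ugraph \<Rightarrow> 'a set \<Rightarrow> 'a set \<Rightarrow> bool" where
  "no_edges_between G S T \<longleftrightarrow> (\<forall>u\<in>S. \<forall>v\<in>T. {u, v} \<notin> edges G)"

definition decomposition ::
  "'a ugraph \<Rightarrow> 'a set \<Rightarrow> 'a set \<Rightarrow> 'a set \<Rightarrow> 'a set \<Rightarrow> bool" where
  "decomposition G X A B C \<longleftrightarrow>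
     X \<union> A \<union> B \<union> C = verts G \<and>
     X \<inter> A = {} \<and> X \<inter> B = {} \<and> X \<inter> C = {} \<and> A \<inter> B = {} \<and> A \<inter> C = {} \<and> B \<inter> C = {} \<and>
     A \<noteq> {} \<and> B \<noteq> {} \<and>
     no_edges_between G A B \<and> no_edges_between G A C \<and> no_edges_between G B C"

definition W_decomposition ::
  "real \<Rightarrow> nat \<Rightarrow> 'a ugraph \<Rightarrow> 'a set \<Rightarrow> 'a set \<Rightarrow> 'a set \<Rightarrow> 'a set \<Rightarrow> 'a set \<Rightarrow> bool" where
  "W_decomposition \<alpha> k G W X A B C \<longleftrightarrow>
     decomposition G X A B C \<and>
     real (card W) < (\<alpha> + 1) * real k \<and>
     real (card X) \<le> \<alpha> * real k \<and>
     real (card ((W \<inter> A) \<union> X)) < (\<alpha> + 1) * real k \<and>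
     real (card ((W \<inter> B) \<union> X)) < (\<alpha> + 1) * real k \<and>
     real (card ((W \<inter> C) \<union> X)) < (\<alpha> + 1) * real k"

datatype 'a outcome = Triangulated "'a ugraph" | Cliquewidth_Exceeded

definition add_edges :: "'a ugraph \<Rightarrow> 'a set set \<Rightarrow> 'a ugraph" where
  "add_edges G F = G\<lparr>edges := edges G \<union> F\<rparr>"

text \<open>
  The search for a decomposition may return any W-decomposition, and fails only if there is none.
  The algorithm is therefore a relation: \<open>triangulate \<alpha> k G W r\<close> means that some run on
  \<open>(G, W)\<close> halts with outcome \<open>r\<close>.  Since the graphs returned by the three recursive calls extend
  induced subgraphs of \<open>G\<close>, rule \<open>glue\<close> yields \<open>G\<close> together with all edges added in
  this call and in the recursive calls.
\<close>

inductive triangulate :: "real \<Rightarrow> nat \<Rightarrow> 'a ugraph \<Rightarrow> 'a set \<Rightarrow> 'a outcome \<Rightarrow> bool"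
  for \<alpha> :: real and k :: nat where
  small:
    "real (card (verts G)) < (2 * \<alpha> + 1) * real k \<Longrightarrow>
     triangulate \<alpha> k G W (Triangulated (add_edges G (pairs (verts G))))"
| not_found:
    "\<lbrakk>\<not> real (card (verts G)) < (2 * \<alpha> + 1) * real k;
      \<nexists>X A B C. W_decomposition \<alpha> k G W X A B C\<rbrakk> \<Longrightarrow>
     triangulate \<alpha> k G W Cliquewidth_Exceeded"
| glue:
    "\<lbrakk>\<not> real (card (verts G)) < (2 * \<alpha> + 1) * real k;
      W_decomposition \<alpha> k G W X A B C;
      triangulate \<alpha> k (induced G (A \<union> X)) ((W \<inter> A) \<union> X) (Triangulated H\<^sub>A);
      triangulate \<alpha> k (induced G (B \<union> X)) ((W \<inter> B) \<union> X) (Triangulated H\<^sub>B);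
      triangulate \<alpha> k (induced G (C \<union> X)) ((W \<inter> C) \<union> X) (Triangulated H\<^sub>C)\<rbrakk> \<Longrightarrow>
     triangulate \<alpha> k G W
       (Triangulated (add_edges G (edges H\<^sub>A \<union> edges H\<^sub>B \<union> edges H\<^sub>C \<union> pairs (W \<union> X))))"
| propagate:
    "\<lbrakk>\<not> real (card (verts G)) < (2 * \<alpha> + 1) * real k;
      W_decomposition \<alpha> k G W X A B C;
      triangulate \<alpha> k (induced G (A \<union> X)) ((W \<inter> A) \<union> X) r\<^sub>A;
      triangulate \<alpha> k (induced G (B \<union> X)) ((W \<inter> B) \<union> X) r\<^sub>B;
      triangulate \<alpha> k (induced G (C \<union> X)) ((W \<inter> C) \<union> X) r\<^sub>C;
      Cliquewidth_Exceeded \<in> {r\<^sub>A, r\<^sub>B, r\<^sub>C}\<rbrakk> \<Longrightarrow>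
     triangulate \<alpha> k G W Cliquewidth_Exceeded"

text \<open>
  \<open>triangulate\<close> says nothing about runs that do not halt.  \<open>recursive_call \<alpha> k c' c\<close> holds if
  some run on input \<open>c\<close> makes a recursive call on input \<open>c'\<close>; every run on \<open>c\<close> halts, whatever
  decompositions the search returns, if \<open>c\<close> is in the accessible part of this relation.
\<close>

inductive recursive_call ::
  "real \<Rightarrow> nat \<Rightarrow> 'a ugraph \<times> 'a set \<Rightarrow> 'a ugraph \<times> 'a set \<Rightarrow> bool"
  for \<alpha> :: real and k :: nat where
  "\<lbrakk>\<not> real (card (verts G)) < (2 * \<alpha> + 1) * real k;
    W_decomposition \<alpha> k G W X A B C;
    S \<in> {A, B, C}\<rbrakk> \<Longrightarrow>
   recursive_call \<alpha> k (induced G (S \<union> X), (W \<inter> S) \<union> X) (G, W)"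

definition always_halts :: "real \<Rightarrow> nat \<Rightarrow> 'a ugraph \<Rightarrow> 'a set \<Rightarrow> bool" where
  "always_halts \<alpha> k G W \<longleftrightarrow> Wellfounded.accp (recursive_call \<alpha> k) (G, W)"

end

theory Submission
  imports Defs
begin

text \<open>
  The output is a clique sum: the graphs returned by the recursive calls meet the clique
  \<open>W \<union> X\<close> in cliques, so chordality is inherited, and every clique lies in one of the pieces or in
  \<open>W \<union> X\<close>, which has fewer than \<open>(\<alpha> + 1) k + \<alpha> k\<close> vertices.

  Conversely, let \<open>H\<close> be a triangulation of \<open>G\<close> with cliques of size at most \<open>k\<close>, and let \<open>X\<close> be
  a largest clique of \<open>H\<close> such that every component of \<open>H - X\<close> contains at most half of \<open>W\<close>.  If
  \<open>H - X\<close> is disconnected, its components can be grouped into three parts that each contain at most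
  half of \<open>W\<close>; this is enough since \<open>(\<alpha> + 1) k / 2 + k \<le> (\<alpha> + 1) k\<close> for \<open>\<alpha> \<ge> 1\<close>.  If it is
  connected, the vertices of \<open>X\<close> with a neighbour outside \<open>X\<close> form a proper subset of \<open>X\<close>, because
  otherwise chordality would yield a vertex adjacent to all of \<open>X\<close>; they separate the rest of \<open>X\<close>
  from \<open>H - X\<close>.
\<close>

section \<open>Graphs, cliques and triangulations\<close>

lemma pairs_iff: "{u, v} \<in> pairs S \<longleftrightarrow> u \<in> S \<and> v \<in> S \<and> u \<noteq> v"
  by (auto simp: pairs_def doubleton_eq_iff)

lemma pairs_mono: "S \<subseteq> T \<Longrightarrow> pairs S \<subseteq> pairs T"
  by (auto simp: pairs_def)

lemma pairs_subset: "e \<in> pairs S \<Longrightarrow> e \<subseteq> S"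
  by (auto simp: pairs_def)

lemma pairs_restrict: "e \<in> pairs S \<Longrightarrow> e \<subseteq> T \<Longrightarrow> e \<in> pairs (S \<inter> T)"
  by (auto simp: pairs_def)

lemma no_edges_between_sym: "no_edges_between G S T \<Longrightarrow> no_edges_between G T S"
  unfolding no_edges_between_def by (metis insert_commute)

lemma no_edges_between_Un:
  "no_edges_between G S (T \<union> T') \<longleftrightarrow> no_edges_between G S T \<and> no_edges_between G S T'"
  by (auto simp: no_edges_between_def)

lemma clique_pairs: "clique G K \<longleftrightarrow> K \<subseteq> verts G \<and> pairs K \<subseteq> edges G"
  by (auto simp: clique_def pairs_def)

lemma clique_subset: "clique G K \<Longrightarrow> L \<subseteq> K \<Longrightarrow> clique G L"
  by (auto simp: clique_def)

lemma clique_insert: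
  assumes "clique G K" "d \<in> verts G" "\<And>x. x \<in> K \<Longrightarrow> {d, x} \<in> edges G"
  shows "clique G (insert d K)"
  using assms by (auto simp: clique_def insert_commute)

lemma clique_induced_iff: "clique (induced G S) K \<longleftrightarrow> clique G K \<and> K \<subseteq> S"
  by (auto simp: clique_def induced_def)

lemma verts_induced [simp]: "verts (induced G S) = verts G \<inter> S"
  by (simp add: induced_def)

lemma fin_graph_induced: "fin_graph G \<Longrightarrow> fin_graph (induced G S)"
  using pairs_restrict by (fastforce simp: fin_graph_def induced_def)

lemma induced_verts:
  assumes "fin_graph (G :: 'a ugraph)"
  shows "induced G (verts G) = G"
proof -
  have "{e \<in> edges G. e \<subseteq> verts G} = edges G"
    using assms pairs_subset by (fastforce simp: fin_graph_def)
  then show ?thesis by (simp add: induced_def)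
qed

lemma finite_clique_cards:
  assumes "fin_graph G"
  shows "finite {card K | K. clique G K}"
proof -
  have "{card K | K. clique G K} \<subseteq> card ` Pow (verts G)"
    by (auto simp: clique_def)
  then show ?thesis
    by (rule finite_subset) (use assms in \<open>simp add: fin_graph_def\<close>)
qed

lemma card_clique_le: "fin_graph G \<Longrightarrow> clique G K \<Longrightarrow> card K \<le> clique_number G"
  unfolding clique_number_def by (rule Max_ge) (auto simp: finite_clique_cards)

lemma clique_number_attained:
  assumes "fin_graph G"
  obtains K where "clique G K" "card K = clique_number G"
proof -
  have "clique G {}" by (simp add: clique_def)
  then have "clique_number G \<in> {card K | K. clique G K}"
    unfolding clique_number_def using assms by (intro Max_in finite_clique_cards) auto
  then show ?thesis using that by auto
qed

lemma clique_number_le_card: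
  assumes "fin_graph G"
  shows "clique_number G \<le> card (verts G)"
proof -
  obtain K where "clique G K" "card K = clique_number G"
    using clique_number_attained assms by blast
  then show ?thesis
    using assms card_mono[of "verts G" K] by (auto simp: clique_def fin_graph_def)
qed

lemma clique_number_induced_le:
  assumes "fin_graph G"
  shows "clique_number (induced G S) \<le> clique_number G"
proof -
  obtain K where "clique (induced G S) K" "card K = clique_number (induced G S)"
    using clique_number_attained fin_graph_induced assms by blast
  then show ?thesis
    using card_clique_le[OF assms, of K] by (auto simp: clique_induced_iff)
qed

section \<open>Cycles, chords and chordality\<close>

lemma nth_in_cycle_edges_iff:
  assumes "distinct p" "i < j" "j < length p"
  shows "{p ! i, p ! j} \<in> cycle_edges p \<longleftrightarrow> j = Suc i \<or> i = 0 \<and> Suc j = length p"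
proof
  assume "{p ! i, p ! j} \<in> cycle_edges p"
  then obtain l where l: "l < length p" "{p ! i, p ! j} = {p ! l, p ! (Suc l mod length p)}"
    by (auto simp: cycle_edges_def)
  have m: "Suc l mod length p < length p" using l(1) by (intro mod_less_divisor) linarith
  have "i = l \<and> j = Suc l mod length p \<or> i = Suc l mod length p \<and> j = l"
    using l(2) nth_eq_iff_index_eq[OF assms(1)] assms l(1) m
    by (auto simp: doubleton_eq_iff)
  moreover have "Suc l mod length p = (if Suc l = length p then 0 else Suc l)"
    using l(1) by simp
  ultimately show "j = Suc i \<or> i = 0 \<and> Suc j = length p"
    using assms by (auto split: if_splits)
next
  assume "j = Suc i \<or> i = 0 \<and> Suc j = length p"
  then show "{p ! i, p ! j} \<in> cycle_edges p"
  proof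
    assume "j = Suc i"
    then show ?thesis using assms unfolding cycle_edges_def
      by (intro CollectI exI[of _ i]) auto
  next
    assume "i = 0 \<and> Suc j = length p"
    then show ?thesis using assms unfolding cycle_edges_def
      by (intro CollectI exI[of _ j]) auto
  qed
qed

lemma chordI:
  assumes "cycle G p" "Suc i < j" "j < length p" "i \<noteq> 0 \<or> Suc j \<noteq> length p"
    "{p ! i, p ! j} \<in> edges G"
  shows "chord G p {p ! i, p ! j}"
  using assms nth_in_cycle_edges_iff[of p i j] by (auto simp: chord_def cycle_def)

lemma cycle_edges_subset: "e \<in> cycle_edges p \<Longrightarrow> e \<subseteq> set p"
proof -
  assume "e \<in> cycle_edges p"
  then obtain i where i: "i < length p" "e = {p ! i, p ! (Suc i mod length p)}"
    by (auto simp: cycle_edges_def)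
  then have "Suc i mod length p < length p" by (intro mod_less_divisor) linarith
  then show ?thesis using i by auto
qed

lemma cycle_induced_iff: "cycle (induced G S) p \<longleftrightarrow> cycle G p \<and> set p \<subseteq> S"
  using cycle_edges_subset by (fastforce simp: cycle_def induced_def)

lemma chord_induced_iff: "set p \<subseteq> S \<Longrightarrow> chord (induced G S) p e \<longleftrightarrow> chord G p e"
  by (auto simp: chord_def induced_def)

lemma chordal_induced: "chordal G \<Longrightarrow> chordal (induced G S)"
  unfolding chordal_def by (metis cycle_induced_iff chord_induced_iff)

text \<open>In a cycle of length more than three, the vertices at positions 0 and 2 are neither
  consecutive nor joined by the closing edge, so the edge between them is a chord.\<close>

lemma chordal_complete:
  assumes "clique G (verts G)"
  shows "chordal G"
  unfolding chordal_def
proof (intro allI impI)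
  fix p
  assume p: "cycle G p \<and> 3 < length p"
  then have "distinct p" "0 < length p" "2 < length p" "set p \<subseteq> verts G"
    by (auto simp: cycle_def)
  then have "p ! 0 \<in> verts G" "p ! 2 \<in> verts G" "p ! 0 \<noteq> p ! 2"
    by (auto simp: nth_eq_iff_index_eq simp del: length_greater_0_conv)
  then have "{p ! 0, p ! 2} \<in> edges G" using assms by (auto simp: clique_def)
  then show "\<exists>e. chord G p e" using p chordI[of G p 0 2] by auto
qed

lemma rotate_edge:
  assumes "i < length p"
  shows "{rotate m p ! i, rotate m p ! (Suc i mod length p)}
    = {p ! ((m + i) mod length p), p ! (Suc ((m + i) mod length p) mod length p)}"
proof -
  have "Suc i mod length p < length p" using assms by (intro mod_less_divisor) linarith
  then have "rotate m p ! (Suc i mod length p) = p ! ((m + Suc i mod length p) mod length p)"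
    by (simp add: nth_rotate)
  also have "(m + Suc i mod length p) mod length p = Suc ((m + i) mod length p) mod length p"
    by (simp add: mod_simps)
  finally show ?thesis using assms by (simp add: nth_rotate)
qed

lemma cycle_edges_rotate_subset: "cycle_edges (rotate m p) \<subseteq> cycle_edges p"
proof
  fix e
  assume "e \<in> cycle_edges (rotate m p)"
  then obtain i where i: "i < length p"
    "e = {rotate m p ! i, rotate m p ! (Suc i mod length p)}"
    by (auto simp: cycle_edges_def)
  have "(m + i) mod length p < length p" using i(1) by (intro mod_less_divisor) linarith
  then show "e \<in> cycle_edges p"
    unfolding i(2) rotate_edge[OF i(1)] cycle_edges_def by blast
qed

lemma cycle_edges_rotate: "cycle_edges (rotate m p) = cycle_edges p"
proof (cases "p = []")
  case False
  \<comment> \<open>Rotating on by this amount makes the total a multiple of the length and so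
    undoes the rotation; the inclusion already proved then yields the reverse one.\<close>
  have "rotate (length p - m mod length p) (rotate m p) = rotate (length p - m mod length p + m) p"
    by (simp add: rotate_rotate)
  also have "(length p - m mod length p + m) mod length p = 0"
    using False
    by (metis Nat.add_diff_assoc2 add.commute le_add_diff_inverse2 length_greater_0_conv
        less_imp_le_nat mod_add_left_eq mod_add_right_eq mod_less_divisor mod_self)
  then have "rotate (length p - m mod length p + m) p = p"
    by (simp add: rotate_id)
  finally show ?thesis
    using cycle_edges_rotate_subset by (metis subset_antisym)
qed (simp add: cycle_edges_def)

lemma cycle_rotate: "cycle G (rotate m p) \<longleftrightarrow> cycle G p"
  by (simp add: cycle_def cycle_edges_rotate)

lemma chord_rotate: "chord G (rotate m p) e \<longleftrightarrow> chord G p e"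
  by (simp add: chord_def cycle_edges_rotate)

lemma cycle_edge_Suc:
  assumes "cycle G p" "Suc i < length p"
  shows "{p ! i, p ! Suc i} \<in> edges G"
  using assms nth_in_cycle_edges_iff[of p i "Suc i"] by (auto simp: cycle_def)

lemma cycle_edge_wrap:
  assumes "cycle G p"
  shows "{p ! (length p - 1), p ! 0} \<in> edges G"
proof -
  have "distinct p" "0 < length p - 1" "length p - 1 < length p" "cycle_edges p \<subseteq> edges G"
    using assms by (auto simp: cycle_def)
  then show ?thesis
    using nth_in_cycle_edges_iff[of p 0 "length p - 1"] by (auto simp: insert_commute)
qed

section \<open>Clique sums\<close>

text \<open>A cycle inside \<open>P\<close> or inside \<open>Q\<close> has its chord there. Any
  other cycle passes through the clique \<open>P \<inter> Q\<close> both before and after a visit to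
  \<open>Q - P\<close>, and the edge between these two vertices is a chord.\<close>

lemma chordal_clique_sum:
  assumes P: "chordal (induced G P)" and Q: "chordal (induced G Q)"
    and cl: "clique G (P \<inter> Q)" and sep: "no_edges_between G (P - Q) (Q - P)"
  shows "chordal (induced G (P \<union> Q))"
  unfolding chordal_def
proof (intro allI impI)
  fix p
  assume "cycle (induced G (P \<union> Q)) p \<and> 3 < length p"
  then have p: "cycle G p" "3 < length p" "set p \<subseteq> P \<union> Q"
    by (auto simp: cycle_induced_iff)
  have "\<exists>e. chord G p e"
  proof (cases "set p \<subseteq> P \<or> set p \<subseteq> Q")
    case True
    then show ?thesis
      using P Q p unfolding chordal_def by (metis cycle_induced_iff chord_induced_iff)
  next
    case False
    then obtain m where m: "m < length p" "p ! m \<in> P - Q"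
      using p(3) by (fastforce simp: in_set_conv_nth subset_iff)
    \<comment> \<open>Starting in \<open>P - Q\<close> keeps the visit to \<open>Q - P\<close> away
      from the wrap-around of the list.\<close>
    define q where "q = rotate m p"
    have q: "cycle G q" "3 < length q" "set q \<subseteq> P \<union> Q"
      using p by (auto simp: q_def cycle_rotate)
    have "rotate m p ! 0 = p ! ((m + 0) mod length p)" using p(2) by (intro nth_rotate) linarith
    then have q0: "q ! 0 \<in> P - Q" using m by (simp add: q_def)
    have "\<not> set q \<subseteq> P" using False by (simp add: q_def)
    then obtain j where j: "j < length q" "q ! j \<in> Q - P"
      using q(3) by (fastforce simp: in_set_conv_nth subset_iff)
    have inU: "q ! i \<in> P \<union> Q" if "i < length q" for i
      using q(3) nth_mem that by blast
    have sep': "{u, v} \<notin> edges G" "{v, u} \<notin> edges G" if "u \<in> P - Q" "v \<in> Q - P" for u v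
      using sep that by (auto simp: no_edges_between_def insert_commute)
    txt \<open>The cycle enters and leaves \<open>Q - P\<close> through two distinct vertices of \<open>P \<inter> Q\<close>.\<close>
    define i where "i = Max {i. i < j \<and> q ! i \<in> P}"
    have "0 < j" using q0 j(2) by (metis DiffD2 DiffD1 gr0I)
    then have "i \<in> {i. i < j \<and> q ! i \<in> P}"
      unfolding i_def using q0 by (intro Max_in) auto
    then have i: "i < j" "q ! i \<in> P" by auto
    have imax: "l \<le> i" if "l < j" "q ! l \<in> P" for l
      unfolding i_def using that by (intro Max_ge) auto
    have iQ: "q ! Suc i \<in> Q - P"
    proof (cases "Suc i = j")
      case False
      then have "Suc i < j" using i by auto
      then show ?thesis using imax[of "Suc i"] inU[of "Suc i"] j by auto
    qed (use j in simp)
    have "{q ! i, q ! Suc i} \<in> edges G" using cycle_edge_Suc[OF q(1)] i j by auto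
    then have iPQ: "q ! i \<in> P \<inter> Q" using sep' iQ i(2) by auto
    \<comment> \<open>A positive index excludes the closing edge, so the pair found below is a chord
      even if \<open>l\<close> is the last position.\<close>
    then have i0: "0 < i" using q0 by (metis DiffD2 IntD2 gr0I)
    \<comment> \<open>Otherwise the last vertex lies in \<open>Q - P\<close>, and the closing edge
      leads from it straight to \<open>q ! 0\<close> in \<open>P - Q\<close>.\<close>
    have "\<exists>l. j < l \<and> l < length q \<and> q ! l \<in> P"
    proof (rule ccontr)
      assume *: "\<not> ?thesis"
      have "q ! (length q - 1) \<in> Q - P"
      proof (cases "j = length q - 1")
        case False
        then show ?thesis using * inU[of "length q - 1"] j by auto
      qed (use j in simp)
      then show False using sep'(2) q0 cycle_edge_wrap[OF q(1)] by blast
    qed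
    define l where "l = (LEAST l. j < l \<and> l < length q \<and> q ! l \<in> P)"
    have l: "j < l" "l < length q" "q ! l \<in> P"
      using LeastI_ex[OF \<open>\<exists>l. j < l \<and> l < length q \<and> q ! l \<in> P\<close>] by (auto simp: l_def)
    have lmin: "l \<le> t" if "j < t" "t < length q" "q ! t \<in> P" for t
      unfolding l_def using that by (intro Least_le) auto
    have lQ: "q ! (l - 1) \<in> Q - P"
    proof (cases "j = l - 1")
      case False
      then have "j < l - 1" "l - 1 < length q" using l by linarith+
      then show ?thesis using lmin[of "l - 1"] inU[of "l - 1"] by auto
    qed (use j in simp)
    have "{q ! (l - 1), q ! l} \<in> edges G" using cycle_edge_Suc[OF q(1), of "l - 1"] l by auto
    then have lPQ: "q ! l \<in> P \<inter> Q" using sep' lQ l(3) by auto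
    have "q ! i \<noteq> q ! l"
      using q(1) i l nth_eq_iff_index_eq[of q i l] by (auto simp: cycle_def)
    then have "{q ! i, q ! l} \<in> edges G" using cl iPQ lPQ by (auto simp: clique_def)
    then have "chord G q {q ! i, q ! l}" using chordI[OF q(1)] i i0 l by auto
    then show ?thesis unfolding q_def chord_rotate by blast
  qed
  then show "\<exists>e. chord (induced G (P \<union> Q)) p e"
    using chord_induced_iff[OF p(3)] by blast
qed

section \<open>Components and separators in chordal graphs\<close>

definition adj_in :: "'a ugraph \<Rightarrow> 'a set \<Rightarrow> ('a \<times> 'a) set" where
  "adj_in G U = {(u, v). u \<in> U \<and> v \<in> U \<and> {u, v} \<in> edges G}"

text \<open>For \<open>u\<close> outside \<open>U\<close> this is the singleton of \<open>u\<close>,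
  because the closure is reflexive; hence the assumption \<open>u \<in> U\<close> in
  \<open>component_subset\<close>.\<close>

definition component :: "'a ugraph \<Rightarrow> 'a set \<Rightarrow> 'a \<Rightarrow> 'a set" where
  "component G U u = {v. (u, v) \<in> (adj_in G U)\<^sup>*}"

lemma component_refl [simp]: "u \<in> component G U u"
  by (simp add: component_def)

lemma component_step:
  "v \<in> component G U u \<Longrightarrow> v \<in> U \<Longrightarrow> w \<in> U \<Longrightarrow> {v, w} \<in> edges G \<Longrightarrow> w \<in> component G U u"
  unfolding component_def adj_in_def by (auto intro: rtrancl_into_rtrancl)

lemma component_sym: "v \<in> component G U u \<Longrightarrow> u \<in> component G U v"
proof -
  have "sym (adj_in G U)" by (auto simp: sym_def adj_in_def insert_commute)
  then show "v \<in> component G U u \<Longrightarrow> u \<in> component G U v"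
    unfolding component_def using sym_rtrancl by (auto dest: symD)
qed

lemma component_trans: "v \<in> component G U u \<Longrightarrow> w \<in> component G U v \<Longrightarrow> w \<in> component G U u"
  by (auto simp: component_def)

lemma component_subset_closed:
  assumes "u \<in> D" "\<And>v w. v \<in> D \<Longrightarrow> w \<in> U \<Longrightarrow> {v, w} \<in> edges G \<Longrightarrow> w \<in> D"
  shows "component G U u \<subseteq> D"
proof
  fix v
  assume "v \<in> component G U u"
  then have "(u, v) \<in> (adj_in G U)\<^sup>*" by (simp add: component_def)
  then show "v \<in> D"
    by (induction rule: rtrancl_induct) (use assms in \<open>auto simp: adj_in_def\<close>)
qed

lemma component_subset: "u \<in> U \<Longrightarrow> component G U u \<subseteq> U"
  by (rule component_subset_closed) auto

lemma component_mono: "U \<subseteq> U' \<Longrightarrow> component G U u \<subseteq> component G U' u"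
  unfolding component_def by (auto intro: rtrancl_mono[THEN subsetD, rotated] simp: adj_in_def)

text \<open>Chordality for a cycle enumerated by an injective function, with the ends of the chord
  as ordered indices: case distinctions on the chord become arithmetic.\<close>

lemma chordal_indexed_cycle:
  assumes "fin_graph G" "chordal G" "4 \<le> N" "inj_on g {..<N}" "g ` {..<N} \<subseteq> verts G"
    and Suc: "\<And>j. Suc j < N \<Longrightarrow> {g j, g (Suc j)} \<in> edges G"
    and wrap: "{g (N - 1), g 0} \<in> edges G"
  obtains a b where "Suc a < b" "b < N" "a \<noteq> 0 \<or> Suc b \<noteq> N" "{g a, g b} \<in> edges G"
proof -
  define p where "p = map g [0..<N]"
  have len: "length p = N" and nth: "\<And>i. i < N \<Longrightarrow> p ! i = g i"
    by (auto simp: p_def)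
  have dist: "distinct p" using assms(4) by (simp add: p_def distinct_map atLeast0LessThan)
  have "cycle_edges p \<subseteq> edges G"
  proof
    fix e
    assume "e \<in> cycle_edges p"
    then obtain i where i: "i < N" "e = {p ! i, p ! (Suc i mod N)}"
      by (auto simp: cycle_edges_def len)
    show "e \<in> edges G"
    proof (cases "Suc i = N")
      case True
      then show ?thesis using i nth[of i] nth[of 0] wrap by auto
    next
      case False
      then show ?thesis using i nth[of i] nth[of "Suc i"] Suc by auto
    qed
  qed
  then have "cycle G p"
    using assms dist by (auto simp: cycle_def len p_def)
  then obtain e where e: "chord G p e"
    using assms len by (auto simp: chordal_def)
  then have "e \<in> pairs (verts G)" "e \<subseteq> set p" "e \<in> edges G"
    using assms(1) by (auto simp: fin_graph_def chord_def)
  then obtain a b where ab: "a < N" "b < N" "e = {g a, g b}" "g a \<noteq> g b"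
    by (auto simp: pairs_def p_def)
  obtain a b where ab: "a < b" "b < N" "e = {g a, g b}"
  proof (cases "a < b")
    case False
    then have "b < a" using ab by (metis linorder_neqE_nat)
    then show ?thesis using that[of b a] ab by auto
  qed (use that ab in auto)
  have "\<not> (b = Suc a \<or> a = 0 \<and> Suc b = N)"
    using nth_in_cycle_edges_iff[OF dist ab(1)] e ab nth by (auto simp: chord_def len)
  then show ?thesis using that[of a b] ab \<open>e \<in> edges G\<close> by auto
qed

text \<open>Take a walk to \<open>T\<close> with the fewest steps: an earlier visit to
  \<open>T\<close>, a shortcut or a repeated vertex would each give a walk with fewer.\<close>

lemma shortest_walk:
  assumes "(u, v) \<in> R\<^sup>*" "v \<in> T"
  shows "\<exists>f n. f 0 = u \<and> f n \<in> T \<and> (\<forall>i<n. (f i, f (Suc i)) \<in> R) \<and> (\<forall>i<n. f i \<notin> T) \<and>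
    (\<forall>i j. Suc i < j \<longrightarrow> j \<le> n \<longrightarrow> (f i, f j) \<notin> R) \<and> inj_on f {..n}"
proof -
  let ?Q = "\<lambda>n. \<exists>t\<in>T. (u, t) \<in> R ^^ n"
  have "\<exists>n. ?Q n" using assms by (auto simp: rtrancl_power)
  then obtain n where n: "?Q n" "\<And>m. m < n \<Longrightarrow> \<not> ?Q m"
    using exists_least_iff[of ?Q] by auto
  then obtain f where f: "f 0 = u" "f n \<in> T" "\<And>i. i < n \<Longrightarrow> (f i, f (Suc i)) \<in> R"
    by (auto simp: relpow_fun_conv)
  have sub: "(f i, f j) \<in> R ^^ (j - i)" if "i \<le> j" "j \<le> n" for i j
    unfolding relpow_fun_conv
    by (rule exI[of _ "\<lambda>t. f (i + t)"]) (use that f in auto)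
  have T: "f i \<notin> T" if "i < n" for i
    using n(2)[OF that] sub[of 0 i] f(1) that by auto
  have noedge: "(f i, f j) \<notin> R" if ij: "Suc i < j" "j \<le> n" for i j
  proof
    assume "(f i, f j) \<in> R"
    then have "(u, f j) \<in> R ^^ Suc i" using sub[of 0 i] f(1) ij by auto
    then have "(u, f n) \<in> R ^^ (Suc i + (n - j))"
      using sub[of j n] ij by (metis le_refl relpow_trans)
    then show False using n(2)[of "Suc i + (n - j)"] f(2) ij by auto
  qed
  have neq: "f i \<noteq> f j" if ij: "i < j" "j \<le> n" for i j
  proof
    assume "f i = f j"
    then have "(u, f j) \<in> R ^^ i" using sub[of 0 i] f(1) ij by auto
    then have "(u, f n) \<in> R ^^ (i + (n - j))"
      using sub[of j n] ij by (metis le_refl relpow_trans)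
    then show False using n(2)[of "i + (n - j)"] f(2) ij by auto
  qed
  have "inj_on f {..n}"
    by (rule linorder_inj_onI) (use neq in auto)
  then show ?thesis using f T noedge by blast
qed

text \<open>
  A vertex of the component with the most neighbours in \<open>X\<close> is adjacent to all of \<open>X\<close>: a shortest
  path from it to the neighbourhood of a missed \<open>x\<close> ends in a vertex with even more neighbours,
  for otherwise \<open>x\<close>, some \<open>y \<in> X\<close> and an end piece of the path form a chordless cycle.
\<close>

lemma common_neighbour_in_component:
  assumes G: "fin_graph G" "chordal G" and X: "clique G X" and U: "U \<subseteq> verts G" "U \<inter> X = {}"
    and u: "u \<in> U" and nb: "\<And>x. x \<in> X \<Longrightarrow> \<exists>v\<in>component G U u. {v, x} \<in> edges G"
  obtains d where "d \<in> component G U u" "\<And>x. x \<in> X \<Longrightarrow> {d, x} \<in> edges G"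
proof -
  define N where "N d = {x \<in> X. {d, x} \<in> edges G}" for d
  have finX: "finite X"
    using X G by (auto simp: clique_def fin_graph_def intro: finite_subset)
  then have "card (N d) \<le> card X" for d by (auto simp: N_def intro!: card_mono)
  then obtain d where d: "d \<in> component G U u"
    and dmax: "\<And>d'. d' \<in> component G U u \<Longrightarrow> card (N d') \<le> card (N d)"
    using ex_has_greatest_nat[of "\<lambda>d. d \<in> component G U u" u "\<lambda>d. card (N d)" "Suc (card X)"]
    by (auto simp: less_Suc_eq_le)
  have dU: "d \<in> U" using d component_subset[OF u] by blast
  have "{d, x} \<in> edges G" if x: "x \<in> X" for x
  proof (rule ccontr)
    assume dx: "{d, x} \<notin> edges G"
    obtain z where z: "z \<in> component G U u" "{z, x} \<in> edges G" using nb x by blast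
    have "z \<in> component G U d" using component_trans[OF component_sym[OF d] z(1)] .
    then have "(d, z) \<in> (adj_in G U)\<^sup>*" by (simp add: component_def)
    moreover have "z \<in> {z. {z, x} \<in> edges G}" using z(2) by simp
    ultimately have "\<exists>f n. f 0 = d \<and> f n \<in> {z. {z, x} \<in> edges G} \<and>
      (\<forall>i<n. (f i, f (Suc i)) \<in> adj_in G U) \<and> (\<forall>i<n. f i \<notin> {z. {z, x} \<in> edges G}) \<and>
      (\<forall>i j. Suc i < j \<longrightarrow> j \<le> n \<longrightarrow> (f i, f j) \<notin> adj_in G U) \<and> inj_on f {..n}"
      by (rule shortest_walk)
    then obtain f n where f0: "f 0 = d" and fn: "f n \<in> {z. {z, x} \<in> edges G}"
      and fR: "\<And>i. i < n \<Longrightarrow> (f i, f (Suc i)) \<in> adj_in G U"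
      and fx: "\<And>i. i < n \<Longrightarrow> f i \<notin> {z. {z, x} \<in> edges G}"
      and fnon: "\<And>i j. Suc i < j \<Longrightarrow> j \<le> n \<Longrightarrow> (f i, f j) \<notin> adj_in G U"
      and finj: "inj_on f {..n}"
      by blast
    have fU: "f i \<in> U" if "i \<le> n" for i
      using that f0 dU fR[of "i - 1"] by (cases i) (auto simp: adj_in_def)
    have fcomp: "f i \<in> component G U u" if "i \<le> n" for i
      using that
    proof (induction i)
      case (Suc i)
      then show ?case
        using component_step[of "f i" G U u "f (Suc i)"] fR[of i] by (auto simp: adj_in_def)
    qed (use f0 d in simp)
    have sub: "N d \<subseteq> N (f n)"
    proof
      fix y
      assume "y \<in> N d"
      then have y: "y \<in> X" "{f 0, y} \<in> edges G" by (auto simp: N_def f0)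
      then have xy: "x \<noteq> y" "{x, y} \<in> edges G"
        using dx f0 X x by (auto simp: clique_def)
      \<comment> \<open>No path vertex after \<open>f i\<close> is adjacent to \<open>y\<close>, so
        the cycle through \<open>y\<close> and this end piece of the path will have no chord at
        \<open>y\<close>.\<close>
      define i where "i = Max {i. i \<le> n \<and> {f i, y} \<in> edges G}"
      have "i \<in> {i. i \<le> n \<and> {f i, y} \<in> edges G}"
        unfolding i_def using y by (intro Max_in) auto
      then have i: "i \<le> n" "{f i, y} \<in> edges G" by auto
      have imax: "l \<le> i" if "l \<le> n" "{f l, y} \<in> edges G" for l
        unfolding i_def using that by (intro Max_ge) auto
      show "y \<in> N (f n)"
      proof (cases "i = n")
        case True
        then show ?thesis using i y by (simp add: N_def)
      next
        case False
        then have "i < n" using i by simp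
        \<comment> \<open>The cycle is \<open>x\<close>, \<open>y\<close>, \<open>f i\<close>, ...,
          \<open>f n\<close>. The two leading vertices cause the shift by 2, and together with the
          \<open>n - i + 1\<close> path vertices they give the length \<open>n - i + 3\<close>,
          which is at least 4.\<close>
        define g where "g j = (if j = 0 then x else if j = 1 then y else f (i + j - 2))" for j
        define M where "M = n - i + 3"
        have gf: "g j = f (i + j - 2)" "i + j - 2 \<le> n" "i + j - 2 \<in> {..n}" if "2 \<le> j" "j < M" for j
          using that \<open>i < n\<close> by (auto simp: g_def M_def)
        have xyU: "x \<notin> U" "y \<notin> U" using U x y by auto
        obtain a b where ab: "Suc a < b" "b < M" "a \<noteq> 0 \<or> Suc b \<noteq> M" "{g a, g b} \<in> edges G"
        proof (rule chordal_indexed_cycle[OF G])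
          show "4 \<le> M" using \<open>i < n\<close> by (simp add: M_def)
          show "inj_on g {..<M}"
          proof (rule linorder_inj_onI)
            fix a b
            assume ab: "a < b" "a \<in> {..<M}" "b \<in> {..<M}"
            show "g a \<noteq> g b"
            proof (cases "2 \<le> a")
              case True
              then show ?thesis
                using ab gf[of a] gf[of b] inj_on_eq_iff[OF finj, of "i + a - 2" "i + b - 2"] by auto
            next
              case False
              then consider "a = 0" "b = 1" | "a < 2" "2 \<le> b" using ab by linarith
              then show ?thesis
              proof cases
                case 2
                then have "g a \<notin> U" using xyU by (auto simp: g_def)
                then show ?thesis using gf[of b] fU 2 ab by auto
              qed (use xy in \<open>simp add: g_def\<close>)
            qed
          qed auto
          show "g ` {..<M} \<subseteq> verts G"
          proof
            fix v
            assume "v \<in> g ` {..<M}"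
            then obtain j where j: "j < M" "v = g j" by auto
            have "x \<in> verts G" "y \<in> verts G" using X x y by (auto simp: clique_def)
            then show "v \<in> verts G"
              using j gf[of j] fU[of "i + j - 2"] U
              by (cases "2 \<le> j") (auto simp: g_def)
          qed
          show "{g j, g (Suc j)} \<in> edges G" if "Suc j < M" for j
          proof -
            consider "j = 0" | "j = 1" | "2 \<le> j" by linarith
            then show ?thesis
            proof cases
              case 1
              then show ?thesis using xy by (simp add: g_def)
            next
              case 2
              then show ?thesis using i by (simp add: g_def insert_commute)
            next
              case 3
              then have "i + j - 2 < n" "i + Suc j - 2 = Suc (i + j - 2)"
                using that \<open>i < n\<close> by (auto simp: M_def)
              then show ?thesis
                using 3 fR[of "i + j - 2"] by (auto simp: g_def adj_in_def)
            qed
          qed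
          show "{g (M - 1), g 0} \<in> edges G"
            using fn \<open>i < n\<close> by (simp add: g_def M_def Suc_diff_le)
        qed (use that in blast)
        \<comment> \<open>A chord at \<open>x\<close> contradicts that \<open>f n\<close> is the
          only path vertex adjacent to \<open>x\<close>, a chord at \<open>y\<close> the choice of
          \<open>i\<close>, and a chord between path vertices the absence of shortcuts.\<close>
        consider "a = 0" | "a = 1" | "2 \<le> a" by linarith
        then show ?thesis
        proof cases
          case 1
          then have "{f (i + b - 2), x} \<in> edges G" "i + b - 2 < n"
            using ab gf[of b] by (auto simp: g_def M_def insert_commute)
          then show ?thesis using fx by blast
        next
          case 2
          then have "{f (i + b - 2), y} \<in> edges G" "i + b - 2 \<le> n" "i < i + b - 2"
            using ab gf[of b] by (auto simp: g_def insert_commute)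
          then show ?thesis using imax[of "i + b - 2"] by auto
        next
          case 3
          then have "{f (i + a - 2), f (i + b - 2)} \<in> edges G" "f (i + a - 2) \<in> U" "f (i + b - 2) \<in> U"
            using ab gf[of b] gf[of a] fU by auto
          then have "(f (i + a - 2), f (i + b - 2)) \<in> adj_in G U" by (simp add: adj_in_def)
          moreover have "Suc (i + a - 2) < i + b - 2" "i + b - 2 \<le> n"
            using 3 ab gf[of b] by auto
          ultimately show ?thesis using fnon by blast
        qed
      qed
    qed
    have "x \<in> N (f n)" "x \<notin> N d" using x fn dx by (auto simp: N_def)
    then have "N d \<subset> N (f n)" using sub by blast
    moreover have "finite (N (f n))" using finX by (simp add: N_def)
    ultimately have "card (N d) < card (N (f n))" by (rule psubset_card_mono[rotated])
    then show False using dmax[OF fcomp[of n]] by simp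
  qed
  then show ?thesis using that d by blast
qed

section \<open>Balanced cliques\<close>

definition balanced :: "'a ugraph \<Rightarrow> 'a set \<Rightarrow> 'a set \<Rightarrow> bool" where
  "balanced G W X \<longleftrightarrow>
    (\<forall>u \<in> verts G - X. 2 * card (W \<inter> component G (verts G - X) u) \<le> card W)"

text \<open>Deleting more vertices only splits components further, so no component gains vertices of
  \<open>W\<close>.\<close>

lemma balanced_mono:
  assumes "fin_graph G" "W \<subseteq> verts G" "balanced G W X" "X \<subseteq> Y"
  shows "balanced G W Y"
  unfolding balanced_def
proof
  fix u
  assume u: "u \<in> verts G - Y"
  have "finite W" using assms by (auto simp: fin_graph_def intro: finite_subset)
  have "component G (verts G - Y) u \<subseteq> component G (verts G - X) u"
    by (rule component_mono) (use assms in auto)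
  then have "card (W \<inter> component G (verts G - Y) u) \<le> card (W \<inter> component G (verts G - X) u)"
    using \<open>finite W\<close> by (intro card_mono) auto
  moreover have "2 * card (W \<inter> component G (verts G - X) u) \<le> card W"
    using u assms by (auto simp: balanced_def)
  ultimately show "2 * card (W \<inter> component G (verts G - Y) u) \<le> card W" by linarith
qed

text \<open>Disjoint shares of more than half each would add up to more than \<open>W\<close>. This
  serves to follow the heavy component when the clique changes, and to see that the complement of a
  heavy set is light.\<close>

lemma heavy_sets_meet:
  assumes "finite W" "card W < 2 * card (W \<inter> S)" "card W < 2 * card (W \<inter> T)"
  shows "S \<inter> T \<noteq> {}"
proof
  assume "S \<inter> T = {}"
  then have "card (W \<inter> S) + card (W \<inter> T) = card ((W \<inter> S) \<union> (W \<inter> T))"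
    using assms(1) by (intro card_Un_disjoint[symmetric]) auto
  also have "\<dots> \<le> card W" using assms(1) by (intro card_mono) auto
  finally show False using assms by linarith
qed

text \<open>
  Otherwise take a clique with a heavy component \<open>D\<close> as small as possible.  Its vertices with
  neighbours in \<open>D\<close>, together with a common neighbour of them in \<open>D\<close>, form a clique whose heavy
  component is a proper subset of \<open>D\<close>.
\<close>

lemma balanced_clique_exists:
  assumes G: "fin_graph G" "chordal G" and W: "W \<subseteq> verts G"
  shows "\<exists>X. clique G X \<and> balanced G W X"
proof (rule ccontr)
  assume no: "\<not> ?thesis"
  have fin: "finite (verts G)" "finite W"
    using G W by (auto simp: fin_graph_def intro: finite_subset)
  let ?comp = "\<lambda>X u. component G (verts G - X) u"
  define heavy where
    "heavy X u \<longleftrightarrow> clique G X \<and> u \<in> verts G - X \<and> card W < 2 * card (W \<inter> ?comp X u)" for X u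
  have ex: "\<exists>u. heavy X u" if "clique G X" for X
    using no that by (auto simp: balanced_def heavy_def not_le)
  have "clique G {}" by (simp add: clique_def)
  then obtain u0 where "heavy {} u0" using ex by blast
  \<comment> \<open>Clique and vertex are packed into a pair because the minimum is taken over both
    at once.\<close>
  then obtain Xu where Xu: "heavy (fst Xu) (snd Xu)"
    and least: "\<And>Yv. heavy (fst Yv) (snd Yv) \<Longrightarrow>
      card (?comp (fst Xu) (snd Xu)) \<le> card (?comp (fst Yv) (snd Yv))"
    using ex_has_least_nat[of "\<lambda>Xu. heavy (fst Xu) (snd Xu)" "({}, u0)"
        "\<lambda>Xu. card (?comp (fst Xu) (snd Xu))"] by auto
  define X u where "X = fst Xu" and "u = snd Xu"
  have h: "heavy X u" using Xu by (simp add: X_def u_def)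
  have hmin: "card (?comp X u) \<le> card (?comp Y v)" if "heavy Y v" for Y v
    using least[of "(Y, v)"] that by (simp add: X_def u_def)
  define D where "D = ?comp X u"
  have X: "clique G X" and u: "u \<in> verts G - X" and wD: "card W < 2 * card (W \<inter> D)"
    using h by (auto simp: heavy_def D_def)
  define S where "S = {x \<in> X. \<exists>v\<in>D. {v, x} \<in> edges G}"
  have D: "D \<subseteq> verts G - X" unfolding D_def using u by (rule component_subset)
  have S: "clique G S" using X by (rule clique_subset) (auto simp: S_def)
  have disj: "verts G - X \<subseteq> verts G" "(verts G - X) \<inter> S = {}" by (auto simp: S_def)
  have nb: "\<And>x. x \<in> S \<Longrightarrow> \<exists>v\<in>?comp X u. {v, x} \<in> edges G" by (auto simp: S_def D_def)
  obtain d where d: "d \<in> D" "\<And>x. x \<in> S \<Longrightarrow> {d, x} \<in> edges G"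
    using common_neighbour_in_component[OF G S disj u nb] unfolding D_def by blast
  define X' where "X' = insert d S"
  have "clique G X'" unfolding X'_def using S d D by (intro clique_insert) auto
  then obtain u' where h': "heavy X' u'" using ex by blast
  define D' where "D' = ?comp X' u'"
  have u': "u' \<in> verts G - X'" and wD': "card W < 2 * card (W \<inter> D')"
    using h' by (auto simp: heavy_def D'_def)
  obtain z where z: "z \<in> D" "z \<in> D'" using heavy_sets_meet[OF fin(2) wD wD'] by blast
  \<comment> \<open>A vertex of \<open>X\<close> adjacent to \<open>D\<close> belongs to
    \<open>S\<close> and hence to \<open>X'\<close>, so a walk that starts in \<open>D\<close> and
    avoids \<open>X'\<close> never leaves \<open>D\<close>.\<close>
  have "?comp X' z \<subseteq> D"
  proof (rule component_subset_closed[OF z(1)])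
    fix v w
    assume vw: "v \<in> D" "w \<in> verts G - X'" "{v, w} \<in> edges G"
    then have "w \<notin> X" by (auto simp: X'_def S_def)
    then show "w \<in> D"
      using vw D component_step[of v G "verts G - X" u w] by (auto simp: D_def)
  qed
  moreover have "D' \<subseteq> ?comp X' z"
    using component_trans[OF component_sym] z(2) unfolding D'_def by fast
  moreover have "d \<notin> D'"
    using component_subset[OF u', of G] by (auto simp: D'_def X'_def)
  ultimately have "D' \<subset> D" using d(1) by blast
  moreover have "finite D" using D fin by (auto intro: finite_subset)
  ultimately have "card D' < card D" by (simp add: psubset_card_mono)
  then show False using hmin[OF h'] by (simp add: D_def D'_def)
qed

section \<open>Existence of a W-decomposition\<close>

text \<open>
  Let \<open>U\<close> be a largest union of components, not all of them, with at most half of \<open>W\<close>, and \<open>K\<close> a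
  further component.  The components outside \<open>U \<union> K\<close>, if any, contain less than half of \<open>W\<close>.
\<close>

lemma balanced_grouping:
  assumes G: "fin_graph G" and W: "W \<subseteq> verts G" and bal: "balanced G W X" and X: "X \<subseteq> verts G"
    and u: "u \<in> verts G - X" and nc: "component G (verts G - X) u \<noteq> verts G - X"
  obtains A B C where "decomposition G X A B C"
    "2 * card (W \<inter> A) \<le> card W" "2 * card (W \<inter> B) \<le> card W" "2 * card (W \<inter> C) \<le> card W"
proof -
  define M where "M = verts G - X"
  have fin: "finite M" "finite W"
    using G W by (auto simp: fin_graph_def M_def intro: finite_subset)
  \<comment> \<open>These sets are exactly the unions of components of the graph without
    \<open>X\<close>.\<close>
  define closed where "closed U \<longleftrightarrow> U \<subseteq> M \<and> no_edges_between G U (M - U)" for U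
  define good where "good U \<longleftrightarrow> closed U \<and> U \<noteq> M \<and> 2 * card (W \<inter> U) \<le> card W" for U
  have closed_comp: "closed (component G M v)" if v: "v \<in> M" for v
    using component_step[of _ G M v] component_subset[OF v]
    by (fastforce simp: closed_def no_edges_between_def)
  have closed_Un: "closed (U \<union> U')" if "closed U" "closed U'" for U U'
    using that by (auto simp: closed_def no_edges_between_def)
  have light: "2 * card (W \<inter> component G M v) \<le> card W" if "v \<in> M" for v
    using bal that by (simp add: balanced_def M_def)
  have u: "u \<in> M" using u by (simp add: M_def)
  have "good (component G M u)" using closed_comp[OF u] light[OF u] nc by (simp add: good_def M_def)
  moreover have "\<forall>U. good U \<longrightarrow> card U \<le> card M"
    using fin by (auto simp: good_def closed_def intro: card_mono)
  ultimately obtain U where U: "good U" and Umax: "\<And>U'. good U' \<Longrightarrow> card U' \<le> card U"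
    using ex_has_greatest_nat[of good "component G M u" card "Suc (card M)"]
    by (auto simp: less_Suc_eq_le)
  have finU: "finite U" using U fin by (auto simp: good_def closed_def intro: finite_subset)
  have "card (component G M u) \<le> card U" by (rule Umax) fact
  moreover have "finite (component G M u)"
    using component_subset[OF u] fin finite_subset by blast
  then have "card (component G M u) > 0" by (metis card_gt_0_iff component_refl empty_iff)
  ultimately have "U \<noteq> {}" by auto
  obtain v where v: "v \<in> M" "v \<notin> U" using U by (auto simp: good_def closed_def)
  define K where "K = component G M v"
  have K: "closed K" "v \<in> K" "K \<subseteq> M" using closed_comp[OF v(1)] by (auto simp: K_def closed_def)
  \<comment> \<open>Since \<open>U\<close> is a union of components, a walk in \<open>M\<close> that
    starts outside \<open>U\<close> cannot enter it.\<close>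
  have "component G M v \<subseteq> M - U"
  proof (rule component_subset_closed)
    fix x y
    assume xy: "x \<in> M - U" "y \<in> M" "{x, y} \<in> edges G"
    then have "{y, x} \<in> edges G" by (simp add: insert_commute)
    then show "y \<in> M - U" using U xy by (auto simp: good_def closed_def no_edges_between_def)
  qed (use v in simp)
  then have "K \<subseteq> M - U" by (simp add: K_def)
  define C where "C = M - (U \<union> K)"
  have UK: "closed (U \<union> K)" using closed_Un U K by (auto simp: good_def)
  have "2 * card (W \<inter> C) \<le> card W"
  proof (cases "U \<union> K = M")
    case True
    then show ?thesis by (simp add: C_def)
  next
    case False
    have "card U < card (U \<union> K)"
      using K v finU fin by (intro psubset_card_mono) (auto intro: finite_subset)
    then have "\<not> good (U \<union> K)" using Umax[of "U \<union> K"] by auto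
    then have h: "card W < 2 * card (W \<inter> (U \<union> K))" using UK False by (auto simp: good_def)
    show ?thesis
    proof (rule ccontr)
      assume "\<not> ?thesis"
      then have "C \<inter> (U \<union> K) \<noteq> {}" using heavy_sets_meet[OF fin(2) _ h] by auto
      then show False by (auto simp: C_def)
    qed
  qed
  moreover have "decomposition G X U K C"
  proof -
    have UM: "U \<subseteq> M" using U by (simp add: good_def closed_def)
    have "no_edges_between G U K" "no_edges_between G U C" "no_edges_between G K C"
      using U K \<open>K \<subseteq> M - U\<close> unfolding good_def closed_def no_edges_between_def C_def by blast+
    then show ?thesis
      unfolding decomposition_def
      using UM K \<open>K \<subseteq> M - U\<close> \<open>U \<noteq> {}\<close> X by (auto simp: C_def M_def)
  qed
  ultimately show ?thesis
    using that U light[OF v(1)] by (auto simp: good_def K_def)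
qed

text \<open>The decomposition is found in a triangulation; passing to the original graph only loses
  edges, which cannot join separated parts.\<close>

lemma decomposition_subgraph:
  assumes "decomposition H X A B C" "verts H = verts G" "edges G \<subseteq> edges H"
  shows "decomposition G X A B C"
proof -
  have "no_edges_between G S T" if "no_edges_between H S T" for S T
    using that assms(3) by (auto simp: no_edges_between_def)
  then show ?thesis using assms(1,2) by (simp add: decomposition_def)
qed

text \<open>Read contrapositively, a failed search rules out every triangulation with cliques of
  size at most \<open>k\<close>, which justifies the answer of rule
  \<open>not_found\<close>.\<close>

lemma W_decomposition_exists:
  assumes tri: "triangulation G H" and cw: "clique_number H \<le> k"
    and k: "k \<ge> 1" and \<alpha>: "\<alpha> \<ge> 1" and W: "W \<subseteq> verts G"
    and cW: "real (card W) < (\<alpha> + 1) * real k"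
    and big: "\<not> real (card (verts G)) < (2 * \<alpha> + 1) * real k"
  shows "\<exists>X A B C. W_decomposition \<alpha> k G W X A B C"
proof -
  have H: "fin_graph H" "chordal H" "verts H = verts G" "edges G \<subseteq> edges H"
    using tri by (auto simp: triangulation_def)
  have WH: "W \<subseteq> verts H" using W H by simp
  have fin: "finite (verts H)" "finite W"
    using H WH by (auto simp: fin_graph_def intro: finite_subset)
  have k\<alpha>: "real k \<le> \<alpha> * real k" "0 < real k" using \<alpha> k by auto
  have le\<alpha>: "real (card Y) \<le> \<alpha> * real k" if "card Y \<le> k" for Y :: "'a set"
    using that k\<alpha> by linarith
  define good where "good X \<longleftrightarrow> clique H X \<and> balanced H W X" for X
  obtain X0 where "good X0"
    using balanced_clique_exists[OF H(1,2) WH] by (auto simp: good_def)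
  moreover have "\<forall>X. good X \<longrightarrow> card X \<le> clique_number H"
    using card_clique_le[OF H(1)] by (auto simp: good_def)
  ultimately obtain X where X: "good X" and Xmax: "\<And>Y. good Y \<Longrightarrow> card Y \<le> card X"
    using ex_has_greatest_nat[of good X0 card "Suc (clique_number H)"] by (auto simp: less_Suc_eq_le)
  have cX: "clique H X" and bX: "balanced H W X" and XV: "X \<subseteq> verts H"
    using X by (auto simp: good_def clique_def)
  have finX: "finite X" using XV fin finite_subset by blast
  have Xk: "card X \<le> k" using card_clique_le[OF H(1) cX] cw by linarith
  \<comment> \<open>As \<alpha> \<ge> 1, the graph has at least 3k vertices, hence one outside the
    clique \<open>X\<close>.\<close>
  have "(2 * \<alpha> + 1) * real k = \<alpha> * real k + \<alpha> * real k + real k" by (simp add: algebra_simps)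
  then have "real (card X) < real (card (verts H))"
    using big Xk k\<alpha> unfolding H(3) by linarith
  then have "verts H \<noteq> X" by auto
  then obtain u where u: "u \<in> verts H - X" using XV by blast
  define D where "D = component H (verts H - X) u"
  \<comment> \<open>Doubled, the estimate is |W| + 2k < (\<alpha> + 3)k \<le> 2(\<alpha> + 1)k, and
    its last step is where \<alpha> \<ge> 1 enters.\<close>
  have half: "real (card ((W \<inter> S) \<union> Y)) < (\<alpha> + 1) * real k"
    if "2 * card (W \<inter> S) \<le> card W" "card Y \<le> k" for S Y
  proof -
    have "card ((W \<inter> S) \<union> Y) \<le> card (W \<inter> S) + card Y" by (rule card_Un_le)
    then have "2 * real (card ((W \<inter> S) \<union> Y)) \<le> real (card W) + 2 * real k"
      using that by linarith
    moreover have "(\<alpha> + 1) * real k = \<alpha> * real k + real k" by (simp add: algebra_simps)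
    ultimately show ?thesis using cW k\<alpha> by linarith
  qed
  show ?thesis
  proof (cases "D = verts H - X")
    case False
    then have nc: "component H (verts H - X) u \<noteq> verts H - X" by (simp add: D_def)
    obtain A B C where "decomposition H X A B C"
      "2 * card (W \<inter> A) \<le> card W" "2 * card (W \<inter> B) \<le> card W" "2 * card (W \<inter> C) \<le> card W"
      by (rule balanced_grouping[OF H(1) WH bX XV u nc])
    then have "W_decomposition \<alpha> k G W X A B C"
      unfolding W_decomposition_def
      using half[OF _ Xk] le\<alpha>[OF Xk] cW decomposition_subgraph[OF _ H(3,4)] by blast
    then show ?thesis by blast
  next
    case True
    txt \<open>The clique \<open>X\<close> does not separate \<open>H\<close>, but by maximality its part adjacent to \<open>D\<close> does.\<close>
    define S where "S = {x \<in> X. \<exists>v\<in>D. {v, x} \<in> edges H}"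
    have "S \<noteq> X"
    proof
      assume "S = X"
      then have nb: "\<And>x. x \<in> X \<Longrightarrow> \<exists>v\<in>component H (verts H - X) u. {v, x} \<in> edges H"
        by (auto simp: S_def D_def)
      obtain d where d: "d \<in> D" "\<And>x. x \<in> X \<Longrightarrow> {d, x} \<in> edges H"
        using common_neighbour_in_component[OF H(1,2) cX Diff_subset _ u nb] unfolding D_def by blast
      then have "d \<in> verts H" "d \<notin> X" using True by auto
      \<comment> \<open>Balance survives the enlargement of \<open>X\<close>, so a common neighbour
        \<open>d\<close> contradicts maximality.\<close>
      then have "good (insert d X)"
        unfolding good_def
        by (intro conjI clique_insert[OF cX] balanced_mono[OF H(1) WH bX] subset_insertI d(2))
      then show False using Xmax[of "insert d X"] \<open>d \<notin> X\<close> finX by simp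
    qed
    then have SX: "S \<subset> X" by (auto simp: S_def)
    have "no_edges_between H (X - S) D"
      by (auto simp: no_edges_between_def S_def insert_commute)
    then have dec: "decomposition H S (X - S) D {}"
      using SX XV True u unfolding decomposition_def
      by (auto simp: no_edges_between_def)
    \<comment> \<open>The set \<open>(W \<inter> (X - S)) \<union> S\<close> lies in
      \<open>X\<close>, so this part meets its bound through the size of the clique, however many
      vertices of \<open>W\<close> it contains.\<close>
    have "card S \<le> card X" "card ((W \<inter> (X - S)) \<union> S) \<le> card X"
      using SX finX by (auto intro!: card_mono)
    then have cS: "card S \<le> k" and c1: "card ((W \<inter> (X - S)) \<union> S) \<le> k" using Xk by linarith+
    have "2 * card (W \<inter> D) \<le> card W" using bX u by (simp add: balanced_def D_def)
    moreover have "real (card ((W \<inter> (X - S)) \<union> S)) < (\<alpha> + 1) * real k"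
      using le\<alpha>[OF c1] k\<alpha>(2) by (simp add: algebra_simps)
    moreover have "2 * card (W \<inter> {}) \<le> card W" by simp
    ultimately have "W_decomposition \<alpha> k G W S (X - S) D {}"
      unfolding W_decomposition_def
      using half[OF _ cS] le\<alpha>[OF cS] cW decomposition_subgraph[OF dec H(3,4)] by blast
    then show ?thesis by blast
  qed
qed

section \<open>Cliquewidth\<close>

lemma verts_add_edges [simp]: "verts (add_edges G F) = verts G"
  by (simp add: add_edges_def)

lemma edges_add_edges [simp]: "edges (add_edges G F) = edges G \<union> F"
  by (simp add: add_edges_def)

lemma triangulation_complete:
  assumes "fin_graph G"
  shows "triangulation G (add_edges G (pairs (verts G)))"
    and "clique (add_edges G (pairs (verts G))) (verts G)"
proof -
  show c: "clique (add_edges G (pairs (verts G))) (verts G)" by (simp add: clique_pairs)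
  then show "triangulation G (add_edges G (pairs (verts G)))"
    using assms by (auto simp: triangulation_def fin_graph_def intro!: chordal_complete)
qed

text \<open>The minimum ranges over a finite non-empty set: clique numbers are bounded by the number
  of vertices, and completing \<open>G\<close> gives one triangulation.\<close>

lemma cliquewidth_gr_iff:
  assumes "fin_graph G"
  shows "k < cliquewidth G \<longleftrightarrow> (\<forall>H. triangulation G H \<longrightarrow> k < clique_number H)"
proof -
  let ?S = "{clique_number H | H. triangulation G H}"
  have "?S \<subseteq> {..card (verts G)}"
    using clique_number_le_card by (fastforce simp: triangulation_def)
  then have "finite ?S" by (rule finite_subset) simp
  moreover have "?S \<noteq> {}" using triangulation_complete(1)[OF assms] by blast
  ultimately show ?thesis
    unfolding cliquewidth_def by (subst Min_gr_iff) auto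
qed

lemma triangulation_induced:
  assumes "triangulation G H"
  shows "triangulation (induced G S) (induced H S)"
  using assms fin_graph_induced[of H S] chordal_induced[of H S]
  by (auto simp: triangulation_def induced_def)

text \<open>Restricting a triangulation of \<open>G\<close> triangulates the induced subgraph
  without creating larger cliques. This carries a negative answer of a recursive call up to the
  caller.\<close>

lemma cliquewidth_induced_gr:
  assumes "fin_graph G" "k < cliquewidth (induced G S)"
  shows "k < cliquewidth G"
  unfolding cliquewidth_gr_iff[OF assms(1)]
proof (intro allI impI)
  fix H
  assume H: "triangulation G H"
  then have "k < clique_number (induced H S)"
    using assms triangulation_induced cliquewidth_gr_iff[OF fin_graph_induced[OF assms(1)]] by blast
  also have "\<dots> \<le> clique_number H"
    using H by (intro clique_number_induced_le) (simp add: triangulation_def)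
  finally show "k < clique_number H" .
qed

section \<open>The recursive algorithm\<close>

text \<open>Here \<open>R\<close> stands for the union of the other two parts and \<open>F\<close>
  for the edges returned by their calls, so the lemma applies to each part in turn. An edge of
  \<open>F\<close> or of the clique on \<open>W \<union> X\<close> that falls inside
  \<open>A \<union> X\<close> has both ends in \<open>(W \<inter> A) \<union> X\<close>, which is
  already a clique of \<open>H\<^sub>A\<close>.\<close>

lemma glue_piece:
  assumes G: "fin_graph G" and V: "verts G = X \<union> A \<union> R"
    and disj: "X \<inter> A = {}" "X \<inter> R = {}" "A \<inter> R = {}"
    and sep: "no_edges_between G A R"
    and tri: "triangulation (induced G (A \<union> X)) H\<^sub>A" and cl: "clique H\<^sub>A ((W \<inter> A) \<union> X)"
    and F: "F \<subseteq> pairs (R \<union> X)"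
    and H: "(H :: 'a ugraph) = add_edges G (edges H\<^sub>A \<union> F \<union> pairs (W \<union> X))"
  shows "induced H (A \<union> X) = H\<^sub>A" "no_edges_between H (A - W) (verts H - (A \<union> X))"
proof -
  have vA: "verts H\<^sub>A = A \<union> X" using tri V by (auto simp: triangulation_def)
  have eA: "edges H\<^sub>A \<subseteq> pairs (A \<union> X)" using tri vA by (auto simp: triangulation_def fin_graph_def)
  have eAG: "e \<in> edges H\<^sub>A" if "e \<in> edges G" "e \<subseteq> A \<union> X" for e
    using tri that by (auto simp: triangulation_def induced_def)
  have cl': "e \<in> edges H\<^sub>A" if "e \<in> pairs ((W \<inter> A) \<union> X)" for e
    using cl that by (auto simp: clique_pairs)
  have "e \<in> edges H\<^sub>A" if e: "e \<in> edges H" "e \<subseteq> A \<union> X" for e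
  proof -
    consider "e \<in> edges G" | "e \<in> edges H\<^sub>A" | "e \<in> pairs (R \<union> X)" | "e \<in> pairs (W \<union> X)"
      using e(1) F by (auto simp: H)
    then show ?thesis
    proof cases
      case 3
      have "(R \<union> X) \<inter> (A \<union> X) \<subseteq> (W \<inter> A) \<union> X" using disj by auto
      then show ?thesis using cl' pairs_restrict[OF 3 e(2)] pairs_mono by blast
    next
      case 4
      have "(W \<union> X) \<inter> (A \<union> X) \<subseteq> (W \<inter> A) \<union> X" by auto
      then show ?thesis using cl' pairs_restrict[OF 4 e(2)] pairs_mono by blast
    qed (use eAG e in auto)
  qed
  then have "edges (induced H (A \<union> X)) = edges H\<^sub>A"
    using eA pairs_subset by (fastforce simp: induced_def H)
  moreover have "verts (induced H (A \<union> X)) = verts H\<^sub>A" using V vA by (auto simp: H)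
  ultimately show "induced H (A \<union> X) = H\<^sub>A" by simp
  show "no_edges_between H (A - W) (verts H - (A \<union> X))"
    unfolding no_edges_between_def
  proof (intro ballI notI)
    fix a v
    assume a: "a \<in> A - W" and v: "v \<in> verts H - (A \<union> X)" and e: "{a, v} \<in> edges H"
    have "v \<in> R" using v V by (auto simp: H)
    then have "{a, v} \<notin> edges G" using sep a by (auto simp: no_edges_between_def)
    moreover have "{a, v} \<notin> edges H\<^sub>A" using eA v by (auto simp: pairs_iff dest!: subsetD)
    moreover have "{a, v} \<notin> F" using F a disj by (auto simp: pairs_iff dest!: subsetD)
    moreover have "{a, v} \<notin> pairs (W \<union> X)" using a disj by (auto simp: pairs_iff)
    ultimately show False using e by (auto simp: H)
  qed
qed

definition solved :: "real \<Rightarrow> nat \<Rightarrow> 'a ugraph \<Rightarrow> 'a set \<Rightarrow> 'a ugraph \<Rightarrow> bool" where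
  "solved \<alpha> k G W H \<longleftrightarrow>
    triangulation G H \<and> clique H W \<and> real (clique_number H) < (2 * \<alpha> + 1) * real k"

text \<open>Starting from the clique on \<open>W \<union> X\<close>, the three pieces are attached
  one at a time. Each attachment is a clique sum, since a piece meets what is already there inside
  \<open>W \<union> X\<close>.\<close>

lemma solved_glue:
  assumes G: "fin_graph G" and W: "W \<subseteq> verts G" and wd: "W_decomposition \<alpha> k G W X A B C"
    and A: "solved \<alpha> k (induced G (A \<union> X)) ((W \<inter> A) \<union> X) H\<^sub>A"
    and B: "solved \<alpha> k (induced G (B \<union> X)) ((W \<inter> B) \<union> X) H\<^sub>B"
    and C: "solved \<alpha> k (induced G (C \<union> X)) ((W \<inter> C) \<union> X) H\<^sub>C"
  shows "solved \<alpha> k G W (add_edges G (edges H\<^sub>A \<union> edges H\<^sub>B \<union> edges H\<^sub>C \<union> pairs (W \<union> X)))"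
proof -
  define H where "H = add_edges G (edges H\<^sub>A \<union> edges H\<^sub>B \<union> edges H\<^sub>C \<union> pairs (W \<union> X))"
  have dec: "decomposition G X A B C" using wd by (simp add: W_decomposition_def)
  then have V: "verts G = X \<union> A \<union> B \<union> C"
    and disj: "X \<inter> A = {}" "X \<inter> B = {}" "X \<inter> C = {}" "A \<inter> B = {}" "A \<inter> C = {}" "B \<inter> C = {}"
    by (auto simp: decomposition_def)
  have sep: "no_edges_between G A (B \<union> C)" "no_edges_between G B (A \<union> C)"
    "no_edges_between G C (A \<union> B)"
    using dec no_edges_between_sym[of G]
    by (auto simp: decomposition_def no_edges_between_Un)
  have edges_S: "edges H\<^sub>S \<subseteq> pairs (S \<union> X)"
    if "solved \<alpha> k (induced G (S \<union> X)) W' H\<^sub>S" for S W' H\<^sub>S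
  proof -
    have "edges H\<^sub>S \<subseteq> pairs (verts G \<inter> (S \<union> X))"
      using that by (auto simp: solved_def triangulation_def fin_graph_def)
    also have "\<dots> \<subseteq> pairs (S \<union> X)" by (rule pairs_mono) simp
    finally show ?thesis .
  qed
  have eA: "edges H\<^sub>A \<subseteq> pairs (A \<union> X)" and eB: "edges H\<^sub>B \<subseteq> pairs (B \<union> X)"
    and eC: "edges H\<^sub>C \<subseteq> pairs (C \<union> X)"
    using edges_S A B C by blast+
  have sub: "F \<union> F' \<subseteq> pairs (S \<union> T \<union> X)" if "F \<subseteq> pairs (S \<union> X)" "F' \<subseteq> pairs (T \<union> X)"
    for F F' S T and X :: "'a set"
    using that by (fastforce simp: pairs_def)
  have "verts G = X \<union> A \<union> (B \<union> C)" "X \<inter> A = {}" "X \<inter> (B \<union> C) = {}" "A \<inter> (B \<union> C) = {}"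
    using V disj by blast+
  moreover have "triangulation (induced G (A \<union> X)) H\<^sub>A" "clique H\<^sub>A ((W \<inter> A) \<union> X)"
    using A by (auto simp: solved_def)
  moreover have "H = add_edges G (edges H\<^sub>A \<union> (edges H\<^sub>B \<union> edges H\<^sub>C) \<union> pairs (W \<union> X))"
    unfolding H_def by (rule arg_cong[where f = "add_edges G"]) blast
  ultimately have pA: "induced H (A \<union> X) = H\<^sub>A" "no_edges_between H (A - W) (verts H - (A \<union> X))"
    using glue_piece[OF G _ _ _ _ sep(1) _ _ sub[OF eB eC]] by blast+
  have "verts G = X \<union> B \<union> (A \<union> C)" "X \<inter> B = {}" "X \<inter> (A \<union> C) = {}" "B \<inter> (A \<union> C) = {}"
    using V disj by blast+
  moreover have "triangulation (induced G (B \<union> X)) H\<^sub>B" "clique H\<^sub>B ((W \<inter> B) \<union> X)"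
    using B by (auto simp: solved_def)
  moreover have "H = add_edges G (edges H\<^sub>B \<union> (edges H\<^sub>A \<union> edges H\<^sub>C) \<union> pairs (W \<union> X))"
    unfolding H_def by (rule arg_cong[where f = "add_edges G"]) blast
  ultimately have pB: "induced H (B \<union> X) = H\<^sub>B" "no_edges_between H (B - W) (verts H - (B \<union> X))"
    using glue_piece[OF G _ _ _ _ sep(2) _ _ sub[OF eA eC]] by blast+
  have "verts G = X \<union> C \<union> (A \<union> B)" "X \<inter> C = {}" "X \<inter> (A \<union> B) = {}" "C \<inter> (A \<union> B) = {}"
    using V disj by blast+
  moreover have "triangulation (induced G (C \<union> X)) H\<^sub>C" "clique H\<^sub>C ((W \<inter> C) \<union> X)"
    using C by (auto simp: solved_def)
  moreover have "H = add_edges G (edges H\<^sub>C \<union> (edges H\<^sub>A \<union> edges H\<^sub>B) \<union> pairs (W \<union> X))"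
    unfolding H_def by (rule arg_cong[where f = "add_edges G"]) blast
  ultimately have pC: "induced H (C \<union> X) = H\<^sub>C" "no_edges_between H (C - W) (verts H - (C \<union> X))"
    using glue_piece[OF G _ _ _ _ sep(3) _ _ sub[OF eA eB]] by blast+
  have vH: "verts H = verts G" by (simp add: H_def)
  have cWX: "clique H (W \<union> X)" using W V by (auto simp: clique_pairs H_def)
  have "A \<union> X \<subseteq> verts H" "B \<union> X \<subseteq> verts H" "C \<union> X \<subseteq> verts H" "W \<union> X \<subseteq> verts H"
    using V W vH by auto
  then have "edges H\<^sub>A \<subseteq> pairs (verts H)" "edges H\<^sub>B \<subseteq> pairs (verts H)" "edges H\<^sub>C \<subseteq> pairs (verts H)"
    "pairs (W \<union> X) \<subseteq> pairs (verts H)"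
    using order_trans[OF eA pairs_mono] order_trans[OF eB pairs_mono]
      order_trans[OF eC pairs_mono] pairs_mono[of "W \<union> X"] by simp_all
  then have "edges H \<subseteq> pairs (verts H)"
    using G by (simp add: H_def fin_graph_def)
  then have finH: "fin_graph H" using G by (simp add: fin_graph_def vH)
  have step: "chordal (induced H ((S \<union> X) \<union> T))"
    if "chordal (induced H (S \<union> X))" "chordal (induced H T)" "T \<inter> S \<subseteq> W" "W \<union> X \<subseteq> T"
      "T \<subseteq> verts H" "no_edges_between H (S - W) (verts H - (S \<union> X))" for S T
  proof (rule chordal_clique_sum[OF that(1,2)])
    show "clique H ((S \<union> X) \<inter> T)" by (rule clique_subset[OF cWX]) (use that(3) in blast)
    show "no_edges_between H ((S \<union> X) - T) (T - (S \<union> X))"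
      using that(4-6) unfolding no_edges_between_def by blast
  qed
  have ch: "chordal (induced H (A \<union> X))" "chordal (induced H (B \<union> X))" "chordal (induced H (C \<union> X))"
    using A B C pA(1) pB(1) pC(1) by (simp_all add: solved_def triangulation_def)
  have c0: "chordal (induced H (W \<union> X))"
    using cWX by (intro chordal_complete) (auto simp: clique_induced_iff intro: clique_subset)
  have c1: "chordal (induced H ((A \<union> X) \<union> (W \<union> X)))"
    by (rule step[OF ch(1) c0 _ _ _ pA(2)]) (use W V disj vH in auto)
  have c2: "chordal (induced H ((B \<union> X) \<union> ((A \<union> X) \<union> (W \<union> X))))"
    by (rule step[OF ch(2) c1 _ _ _ pB(2)]) (use W V disj vH in auto)
  have "chordal (induced H ((C \<union> X) \<union> ((B \<union> X) \<union> ((A \<union> X) \<union> (W \<union> X)))))"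
    by (rule step[OF ch(3) c2 _ _ _ pC(2)]) (use W V disj vH in auto)
  moreover have "(C \<union> X) \<union> ((B \<union> X) \<union> ((A \<union> X) \<union> (W \<union> X))) = verts H" using V W vH by auto
  ultimately have "chordal H" using induced_verts[OF finH] by simp
  then have tri: "triangulation G H" using finH by (auto simp: triangulation_def H_def)
  obtain K where K: "clique H K" "card K = clique_number H"
    using clique_number_attained finH by blast
  \<comment> \<open>A vertex of \<open>S - W\<close> has all its neighbours in
    \<open>S \<union> X\<close>, so a clique through it stays within one piece and inherits the
    bound of that recursive call.\<close>
  have piece: "K \<subseteq> S \<union> X"
    if "no_edges_between H (S - W) (verts H - (S \<union> X))" "a \<in> K" "a \<in> S - W" for S a
  proof
    fix v
    assume v: "v \<in> K"
    have "v \<in> verts H" "v \<noteq> a \<Longrightarrow> {a, v} \<in> edges H"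
      using K(1) v that(2) by (auto simp: clique_def)
    then show "v \<in> S \<union> X" using that(1,3) by (auto simp: no_edges_between_def)
  qed
  have small: "real (card K) < (2 * \<alpha> + 1) * real k"
    if "K \<subseteq> S \<union> X" "induced H (S \<union> X) = H\<^sub>S"
      "solved \<alpha> k (induced G (S \<union> X)) ((W \<inter> S) \<union> X) H\<^sub>S" for S H\<^sub>S
  proof -
    have "clique H\<^sub>S K" using K that by (auto simp: clique_induced_iff)
    then have "card K \<le> clique_number H\<^sub>S"
      using that by (intro card_clique_le) (auto simp: solved_def triangulation_def)
    then show ?thesis using that by (auto simp: solved_def)
  qed
  have "real (card K) < (2 * \<alpha> + 1) * real k"
  proof (cases "K \<subseteq> W \<union> X")
    case True
    have "finite (W \<union> X)" using G W V by (auto simp: fin_graph_def intro: finite_subset)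
    then have "card K \<le> card W + card X"
      using card_mono[OF _ True] card_Un_le[of W X] by linarith
    then show ?thesis using wd by (auto simp: W_decomposition_def algebra_simps)
  next
    case False
    then obtain a where a: "a \<in> K" "a \<notin> W \<union> X" by blast
    then consider "a \<in> A - W" | "a \<in> B - W" | "a \<in> C - W"
      using K(1) V vH by (auto simp: clique_def)
    then show ?thesis
    proof cases
      case 1
      then show ?thesis by (rule small[OF piece[OF pA(2) a(1)] pA(1) A])
    next
      case 2
      then show ?thesis by (rule small[OF piece[OF pB(2) a(1)] pB(1) B])
    next
      case 3
      then show ?thesis by (rule small[OF piece[OF pC(2) a(1)] pC(1) C])
    qed
  qed
  moreover have "clique H W" using cWX by (rule clique_subset) auto
  ultimately show ?thesis using tri K(2) by (simp add: solved_def H_def)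
qed

section \<open>Correctness and termination of the recursion\<close>

text \<open>The conditions on the input are an invariant of the recursion, and the number of
  vertices is its measure: as \<open>A\<close> and \<open>B\<close> are both non-empty, every
  recursive call misses a vertex of one of them.\<close>

lemma recursive_input:
  assumes "fin_graph G" "W \<subseteq> verts G" "W_decomposition \<alpha> k G W X A B C" "S \<in> {A, B, C}"
  shows "fin_graph (induced G (S \<union> X))"
    and "(W \<inter> S) \<union> X \<subseteq> verts (induced G (S \<union> X))"
    and "real (card ((W \<inter> S) \<union> X)) < (\<alpha> + 1) * real k"
    and "card (verts (induced G (S \<union> X))) < card (verts G)"
proof -
  show "fin_graph (induced G (S \<union> X))" using assms(1) by (rule fin_graph_induced)
  have "decomposition G X A B C" using assms(3) by (simp add: W_decomposition_def)
  then have V: "verts G = X \<union> A \<union> B \<union> C" and ne: "A \<noteq> {}" "B \<noteq> {}"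
    and disj: "X \<inter> A = {}" "X \<inter> B = {}" "A \<inter> B = {}" "A \<inter> C = {}"
    by (simp_all add: decomposition_def)
  have "X \<subseteq> verts G" by (auto simp: V)
  then show "(W \<inter> S) \<union> X \<subseteq> verts (induced G (S \<union> X))" using assms(2) by auto
  show "real (card ((W \<inter> S) \<union> X)) < (\<alpha> + 1) * real k"
    using assms(3,4) by (auto simp: W_decomposition_def)
  obtain a b where ab: "a \<in> A" "b \<in> B" using ne by blast
  then have "a \<notin> S \<union> X \<or> b \<notin> S \<union> X" using disj assms(4) by (elim insertE emptyE) auto
  moreover have "a \<in> verts G" "b \<in> verts G" using ab by (auto simp: V)
  ultimately have "verts G \<inter> (S \<union> X) \<subset> verts G" by auto
  then show "card (verts (induced G (S \<union> X))) < card (verts G)"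
    using assms(1) by (auto simp: fin_graph_def intro: psubset_card_mono)
qed

text \<open>Induction on the derivation of the run. The conditions on the input stay among the
  premises, so that they can be re-established for the recursive calls.\<close>

lemma triangulate_correct:
  assumes "triangulate \<alpha> k G W r" "fin_graph G" "k \<ge> 1" "\<alpha> \<ge> 1" "W \<subseteq> verts G"
    "real (card W) < (\<alpha> + 1) * real k"
  shows "case r of Triangulated H \<Rightarrow> solved \<alpha> k G W H | Cliquewidth_Exceeded \<Rightarrow> cliquewidth G > k"
  using assms
proof (induction rule: triangulate.induct)
  case (small G W)
  let ?H = "add_edges G (pairs (verts G))"
  have t: "triangulation G ?H" "clique ?H W"
    using triangulation_complete[OF small.prems(1)] small.prems by (auto intro: clique_subset)
  have "clique_number ?H \<le> card (verts G)"
    using t clique_number_le_card[of ?H] by (simp add: triangulation_def)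
  then show ?case using small t by (simp add: solved_def)
next
  case (not_found G W)
  have "k < clique_number H" if "triangulation G H" for H
  proof (rule ccontr)
    assume "\<not> k < clique_number H"
    then have "clique_number H \<le> k" by simp
    then have "\<exists>X A B C. W_decomposition \<alpha> k G W X A B C"
      using W_decomposition_exists[OF that] not_found.hyps(1) not_found.prems by blast
    then show False using not_found.hyps(2) by blast
  qed
  then show ?case using cliquewidth_gr_iff[OF not_found.prems(1)] by simp
next
  case (glue G W X A B C H\<^sub>A H\<^sub>B H\<^sub>C)
  note r = recursive_input[OF glue.prems(1,4) glue.hyps(2)]
  have "solved \<alpha> k (induced G (A \<union> X)) ((W \<inter> A) \<union> X) H\<^sub>A"
    using glue.IH(1)[OF r(1) glue.prems(2,3) r(2,3)] by simp
  moreover have "solved \<alpha> k (induced G (B \<union> X)) ((W \<inter> B) \<union> X) H\<^sub>B"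
    using glue.IH(2)[OF r(1) glue.prems(2,3) r(2,3)] by simp
  moreover have "solved \<alpha> k (induced G (C \<union> X)) ((W \<inter> C) \<union> X) H\<^sub>C"
    using glue.IH(3)[OF r(1) glue.prems(2,3) r(2,3)] by simp
  ultimately show ?case
    using solved_glue[OF glue.prems(1,4) glue.hyps(2)] by simp
next
  case (propagate G W X A B C r\<^sub>A r\<^sub>B r\<^sub>C)
  note r = recursive_input[OF propagate.prems(1,4) propagate.hyps(2)]
  consider "r\<^sub>A = Cliquewidth_Exceeded" | "r\<^sub>B = Cliquewidth_Exceeded" | "r\<^sub>C = Cliquewidth_Exceeded"
    using propagate.hyps by blast
  then have "\<exists>S. k < cliquewidth (induced G S)"
  proof cases
    case 1
    then show ?thesis using propagate.IH(1)[OF r(1) propagate.prems(2,3) r(2,3)] by auto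
  next
    case 2
    then show ?thesis using propagate.IH(2)[OF r(1) propagate.prems(2,3) r(2,3)] by auto
  next
    case 3
    then show ?thesis using propagate.IH(3)[OF r(1) propagate.prems(2,3) r(2,3)] by auto
  qed
  then show ?case using cliquewidth_induced_gr[OF propagate.prems(1)] by auto
qed

text \<open>Whatever decompositions the search returns, the number of vertices strictly decreases
  along recursive calls.\<close>

lemma triangulate_halts:
  assumes "fin_graph G" "W \<subseteq> verts G"
  shows "always_halts \<alpha> k G W"
  unfolding always_halts_def using assms
proof (induction "card (verts G)" arbitrary: G W rule: less_induct)
  case less
  show ?case
  proof (rule accp.accI)
    fix c
    assume "recursive_call \<alpha> k c (G, W)"
    then show "Wellfounded.accp (recursive_call \<alpha> k) c"
    proof (cases rule: recursive_call.cases)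
      case (1 X A B C S)
      note r = recursive_input[OF less.prems 1(3,4)]
      show ?thesis unfolding 1(1) by (rule less.hyps[OF r(4,1,2)])
    qed
  qed
qed

text \<open>Correctness quantifies over all outcomes and would hold vacuously if there were none. An
  outcome is built by induction on the number of vertices, from outcomes of all three calls when a
  decomposition exists.\<close>

lemma triangulate_total:
  assumes "fin_graph G" "W \<subseteq> verts G"
  shows "\<exists>r. triangulate \<alpha> k G W r"
  using assms
proof (induction "card (verts G)" arbitrary: G W rule: less_induct)
  case less
  show ?case
  proof (cases "real (card (verts G)) < (2 * \<alpha> + 1) * real k")
    case True
    then show ?thesis by (intro exI) (rule triangulate.small)
  next
    case big: False
    show ?thesis
    proof (cases "\<exists>X A B C. W_decomposition \<alpha> k G W X A B C")
      case False
      then show ?thesis by (intro exI) (rule triangulate.not_found[OF big])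
    next
      case True
      then obtain X A B C where wd: "W_decomposition \<alpha> k G W X A B C" by blast
      have run: "\<exists>r. triangulate \<alpha> k (induced G (S \<union> X)) ((W \<inter> S) \<union> X) r" if "S \<in> {A, B, C}" for S
      proof -
        note r = recursive_input[OF less.prems wd that]
        show ?thesis by (rule less.hyps[OF r(4,1,2)])
      qed
      obtain r\<^sub>A where rA: "triangulate \<alpha> k (induced G (A \<union> X)) ((W \<inter> A) \<union> X) r\<^sub>A"
        using run[of A] by auto
      obtain r\<^sub>B where rB: "triangulate \<alpha> k (induced G (B \<union> X)) ((W \<inter> B) \<union> X) r\<^sub>B"
        using run[of B] by auto
      obtain r\<^sub>C where rC: "triangulate \<alpha> k (induced G (C \<union> X)) ((W \<inter> C) \<union> X) r\<^sub>C"
        using run[of C] by auto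
      show ?thesis
      proof (cases "Cliquewidth_Exceeded \<in> {r\<^sub>A, r\<^sub>B, r\<^sub>C}")
        case True
        show ?thesis by (intro exI) (rule triangulate.propagate[OF big wd rA rB rC True])
      next
        case False
        then obtain H\<^sub>A H\<^sub>B H\<^sub>C where
          H: "r\<^sub>A = Triangulated H\<^sub>A" "r\<^sub>B = Triangulated H\<^sub>B" "r\<^sub>C = Triangulated H\<^sub>C"
          by (cases r\<^sub>A; cases r\<^sub>B; cases r\<^sub>C) auto
        show ?thesis
          by (intro exI) (rule triangulate.glue[OF big wd rA[unfolded H] rB[unfolded H] rC[unfolded H]])
      qed
    qed
  qed
qed

theorem theorem3:
  fixes G :: "'a ugraph" and W :: "'a set" and k :: nat and \<alpha> :: real
  assumes "fin_graph G"
    and "k \<ge> 1"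
    and "\<alpha> \<ge> 1"
    and "W \<subseteq> verts G"
    and "real (card W) < (\<alpha> + 1) * real k"
  shows "always_halts \<alpha> k G W \<and>
    (\<exists>r. triangulate \<alpha> k G W r) \<and>
    (\<forall>r. triangulate \<alpha> k G W r \<longrightarrow>
      (case r of
        Triangulated H \<Rightarrow>
          triangulation G H \<and> clique H W \<and> real (clique_number H) < (2 * \<alpha> + 1) * real k
      | Cliquewidth_Exceeded \<Rightarrow> cliquewidth G > k))"
proof (intro conjI allI impI)
  show "always_halts \<alpha> k G W" using assms(1,4) by (rule triangulate_halts)
  show "\<exists>r. triangulate \<alpha> k G W r" using assms(1,4) by (rule triangulate_total)
  fix r
  assume "triangulate \<alpha> k G W r"
  then have "case r of Triangulated H \<Rightarrow> solved \<alpha> k G W H | Cliquewidth_Exceeded \<Rightarrow> cliquewidth G > k"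
    using assms by (rule triangulate_correct)
  then show "case r of
      Triangulated H \<Rightarrow>
        triangulation G H \<and> clique H W \<and> real (clique_number H) < (2 * \<alpha> + 1) * real k
    | Cliquewidth_Exceeded \<Rightarrow> cliquewidth G > k"
    by (simp only: solved_def)
qed

end
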